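(* For every $k\in\mathbb{N}$ there exists a finite generating set $\mathcal{A}$ for the infinite cyclic group $\mathbb{Z}$ such that some element of $\mathbb{Z}$ has (dead-end) depth greater than $k$ with respect to $\mathcal{A}$.
   Context: For a group $G$ with finite generating set $\mathcal{A}$, let $d_{\mathcal{A}}$ be the associated word metric (distances measured by shortest words in $\mathcal{A}^{\pm1}$). The dead-end depth (or depth) of $g\in G$ with respect to $\mathcal{A}$ is the distance, in $d_{\mathcal{A}}$, from $g$ to the complement in $G$ of the closed ball of radius $d_{\mathcal{A}}(1,g)$ centered at the identity $1$ (for $\mathbb{Z}$, written additively, the identity is $0$); it is $\infty$ if that ball is all of $G$. *)

theory Defs
  imports "HOL-Algebra.Elementary_Groups" "HOL-Library.Extended_Nat"
begin

definition generating_set :: "('a, 'b) monoid_scheme \<Rightarrow> 'a set \<Rightarrow> bool" where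
  "generating_set G A \<longleftrightarrow> A \<subseteq> carrier G \<and> generate G A = carrier G"

definition words :: "('a, 'b) monoid_scheme \<Rightarrow> 'a set \<Rightarrow> 'a list set" where
  "words G A = lists (A \<union> m_inv G ` A)"

definition eval_word :: "('a, 'b) monoid_scheme \<Rightarrow> 'a list \<Rightarrow> 'a" where
  "eval_word G w = foldr (mult G) w (one G)"

(* The value is infinity exactly when no word leads from g to h, which does not happen
   for elements of the carrier when A generates G. *)
definition word_dist :: "('a, 'b) monoid_scheme \<Rightarrow> 'a set \<Rightarrow> 'a \<Rightarrow> 'a \<Rightarrow> enat" where
  "word_dist G A g h = (INF w \<in> {w \<in> words G A. mult G g (eval_word G w) = h}. enat (length w))"

definition word_cball :: "('a, 'b) monoid_scheme \<Rightarrow> 'a set \<Rightarrow> 'a \<Rightarrow> enat \<Rightarrow> 'a set" where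
  "word_cball G A g r = {h \<in> carrier G. word_dist G A g h \<le> r}"

(* The infimum of the empty set in enat is infinity, as required when the ball is all of G. *)
definition dead_end_depth :: "('a, 'b) monoid_scheme \<Rightarrow> 'a set \<Rightarrow> 'a \<Rightarrow> enat" where
  "dead_end_depth G A g =
     (INF h \<in> carrier G - word_cball G A (one G) (word_dist G A (one G) g). word_dist G A g h)"

end

theory Submission
  imports Defs
begin

text \<open>
  For the generators \<open>1\<close>, \<open>M - 1\<close>, \<open>M\<close>, \<open>M + 1\<close> the ball of radius \<open>m\<close> about \<open>0\<close> consists of the
  integers \<open>a * M + b\<close> with \<open>\<bar>a\<bar>, \<bar>b\<bar> \<le> m\<close>. Take \<open>M = 2 * n\<close> with \<open>n = k + 1\<close>. Residues modulo \<open>M\<close>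
  have representatives of absolute value at most \<open>n\<close>, and \<open>n\<close> itself has none smaller, so \<open>n\<close> has
  length at least \<open>n\<close>. Moving from \<open>n\<close> by \<open>a * M + b\<close> with \<open>\<bar>a\<bar>, \<bar>b\<bar> \<le> k\<close> leads to
  \<open>a * M + (n + b) = (a + 1) * M + (b - n)\<close>, and one of these two representations shows that the
  result still has length at most \<open>n\<close>.
\<close>

definition depth_gens :: "int \<Rightarrow> int set" where
  "depth_gens M = {1, M - 1, M, M + 1}"

lemma words_integer_group: "words integer_group A = lists (A \<union> uminus ` A)"
proof -
  have "m_inv integer_group = (uminus :: int \<Rightarrow> int)"
    by (rule ext) simp
  then show ?thesis
    by (simp add: words_def)
qed

lemma eval_word_integer_group: "eval_word integer_group w = sum_list w"
  by (induction w) (simp_all add: eval_word_def integer_group_def)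

lemma word_dist_integer_group:
  "word_dist integer_group A g h =
     (INF w \<in> {w \<in> lists (A \<union> uminus ` A). g + sum_list w = h}. enat (length w))"
  by (simp add: word_dist_def words_integer_group eval_word_integer_group)

lemma generating_set_depth_gens: "generating_set integer_group (depth_gens M)"
proof -
  have "generate integer_group {1} \<subseteq> generate integer_group (depth_gens M)"
    by (rule group.mono_generate) (auto simp: depth_gens_def)
  moreover have "generate integer_group {1} = (UNIV :: int set)"
  proof -
    have "x [^]\<^bsub>integer_group\<^esub> (n :: int) = n * x" for x n :: int
      by simp
    then show ?thesis
      by (subst group.generate_pow) auto
  qed
  ultimately show ?thesis
    by (auto simp: generating_set_def)
qed

text \<open>Every letter has the form \<open>c * M + d\<close> with \<open>c\<close> and
  \<open>d\<close> in {-1, 0, 1}, so each letter changes either coordinate by at most one.\<close>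

lemma depth_gens_word_coords:
  assumes "w \<in> lists (depth_gens M \<union> uminus ` depth_gens M)"
  obtains a b where "sum_list w = a * M + b" "\<bar>a\<bar> \<le> int (length w)" "\<bar>b\<bar> \<le> int (length w)"
proof -
  have "\<exists>a b. sum_list w = a * M + b \<and> \<bar>a\<bar> \<le> int (length w) \<and> \<bar>b\<bar> \<le> int (length w)"
    using assms
  proof (induction w)
    case Nil
    show ?case by simp
  next
    case (Cons x w)
    then obtain a b where ab: "sum_list w = a * M + b"
      "\<bar>a\<bar> \<le> int (length w)" "\<bar>b\<bar> \<le> int (length w)"
      by auto
    \<comment> \<open>The eight letters are spelled out with both coefficients, so that
      \<open>c\<close> and \<open>d\<close> can be read off by matching.\<close>
    have "x \<in> {0 * M + 1, 1 * M + - 1, 1 * M + 0, 1 * M + 1,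
               0 * M + - 1, - 1 * M + 1, - 1 * M + 0, - 1 * M + - 1}"
      using Cons.hyps by (auto simp: depth_gens_def)
    then obtain c d where cd: "x = c * M + d" "\<bar>c\<bar> \<le> 1" "\<bar>d\<bar> \<le> 1"
      by fastforce
    have "sum_list (x # w) = (c + a) * M + (d + b)"
      using ab cd by (simp add: algebra_simps)
    moreover have "\<bar>c + a\<bar> \<le> int (length (x # w))" "\<bar>d + b\<bar> \<le> int (length (x # w))"
      using ab cd by auto
    ultimately show ?case by blast
  qed
  then show ?thesis using that by blast
qed

text \<open>Up to inverses, the generators realise all eight king moves on pairs
  \<open>(a, b)\<close>. One letter can thus reduce both coordinates at once, and the maximum of
  their absolute values, not the sum, bounds the length.\<close>

lemma depth_gens_word_exists:
  assumes "\<bar>a\<bar> \<le> int m" "\<bar>b\<bar> \<le> int m"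
  obtains w where "w \<in> lists (depth_gens M \<union> uminus ` depth_gens M)"
    "sum_list w = a * M + b" "length w \<le> m"
proof -
  let ?S = "depth_gens M \<union> uminus ` depth_gens M"
  have "\<exists>w \<in> lists ?S. sum_list w = a * M + b \<and> length w \<le> m"
    using assms
  proof (induction m arbitrary: a b)
    case 0
    then show ?case by (intro bexI[of _ "[]"]) auto
  next
    case (Suc m)
    show ?case
    proof (cases "a = 0 \<and> b = 0")
      case True
      then show ?thesis by (intro bexI[of _ "[]"]) auto
    next
      case False
      have "\<bar>a - sgn a\<bar> \<le> int m" "\<bar>b - sgn b\<bar> \<le> int m"
        using Suc.prems by (auto simp: sgn_if)
      then obtain w where w: "w \<in> lists ?S" "length w \<le> m"
        "sum_list w = (a - sgn a) * M + (b - sgn b)"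
        using Suc.IH by blast
      \<comment> \<open>The pair of signs is not \<open>(0, 0)\<close>, the only one that yields no
        letter.\<close>
      have "sgn a * M + sgn b \<in> ?S"
        using False by (auto simp: sgn_if depth_gens_def)
      with w show ?thesis
        by (intro bexI[of _ "(sgn a * M + sgn b) # w"]) (auto simp: algebra_simps)
    qed
  qed
  then show ?thesis using that by blast
qed

theorem proposition2:
  fixes k :: nat
  shows "\<exists>A :: int set. finite A \<and> generating_set integer_group A \<and>
           (\<exists>g \<in> carrier integer_group. dead_end_depth integer_group A g > enat k)"
proof -
  define n where "n = int (Suc k)"
  define A where "A = depth_gens (2 * n)"
  let ?S = "A \<union> uminus ` A"
  have length_n: "word_dist integer_group A 0 n \<ge> enat (Suc k)"
    unfolding word_dist_integer_group
  proof (rule INF_greatest)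
    fix w assume "w \<in> {w \<in> lists ?S. 0 + sum_list w = n}"
    then have w: "w \<in> lists ?S" "sum_list w = n" by auto
    obtain a b where "sum_list w = a * (2 * n) + b" "\<bar>b\<bar> \<le> int (length w)"
      using w(1) unfolding A_def by (rule depth_gens_word_coords)
    with w(2) have ab: "n = a * (2 * n) + b" "\<bar>b\<bar> \<le> int (length w)" by simp_all
    have "\<not> length w < Suc k"
    proof
      assume "length w < Suc k"
      then have "\<bar>b\<bar> < n" using ab by (simp add: n_def)
      \<comment> \<open>The contradiction: \<open>n - b\<close> would be a multiple of
        \<open>2 * n\<close> strictly between \<open>0\<close> and \<open>2 * n\<close>.\<close>
      then have "0 < n - b" "n - b < 2 * n" by auto
      moreover have "2 * n dvd n - b" using ab(1) by (metis add_diff_cancel_right' dvd_triv_right)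
      ultimately show False using zdvd_not_zless by blast
    qed
    then show "enat (Suc k) \<le> enat (length w)" by simp
  qed
  have "enat (Suc k) \<le> dead_end_depth integer_group A n"
    unfolding dead_end_depth_def word_dist_integer_group[of A n]
  \<comment> \<open>Depth is an infimum over \<open>h\<close> of an infimum over words, so it
    suffices to bound the length of each word leading from \<open>n\<close> out of the ball.\<close>
  proof (intro INF_greatest)
    fix h w
    assume h: "h \<in> carrier integer_group
      - word_cball integer_group A \<one>\<^bsub>integer_group\<^esub> (word_dist integer_group A \<one>\<^bsub>integer_group\<^esub> n)"
      and "w \<in> {w \<in> lists ?S. n + sum_list w = h}"
    then have w: "w \<in> lists ?S" "h = n + sum_list w" by auto
    obtain a b where "sum_list w = a * (2 * n) + b"
      "\<bar>a\<bar> \<le> int (length w)" "\<bar>b\<bar> \<le> int (length w)"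
      using w(1) unfolding A_def by (rule depth_gens_word_coords)
    with w(2) have ab: "h = n + (a * (2 * n) + b)"
      "\<bar>a\<bar> \<le> int (length w)" "\<bar>b\<bar> \<le> int (length w)" by simp_all
    have "\<not> length w < Suc k"
    proof
      assume "length w < Suc k"
      then have le: "\<bar>a\<bar> \<le> int k" "\<bar>b\<bar> \<le> int k" using ab by auto
      have "\<exists>a' b'. h = a' * (2 * n) + b' \<and> \<bar>a'\<bar> \<le> int (Suc k) \<and> \<bar>b'\<bar> \<le> int (Suc k)"
      \<comment> \<open>The sign of \<open>b\<close> decides: \<open>n + b\<close> lies between
        \<open>1\<close> and \<open>n\<close> if \<open>b \<le> 0\<close>, and \<open>b - n\<close>
        lies between \<open>-k\<close> and \<open>-1\<close> otherwise. The shift to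
        \<open>a + 1\<close> costs at most one, which \<open>Suc k\<close> allows.\<close>
      proof (cases "b \<le> 0")
        case True
        then show ?thesis
          using ab(1) le by (intro exI[of _ a] exI[of _ "n + b"]) (auto simp: n_def)
      next
        case False
        then show ?thesis
          using ab(1) le
          by (intro exI[of _ "a + 1"] exI[of _ "b - n"]) (auto simp: n_def algebra_simps)
      qed
      then obtain a' b' where ab': "h = a' * (2 * n) + b'"
        "\<bar>a'\<bar> \<le> int (Suc k)" "\<bar>b'\<bar> \<le> int (Suc k)" by blast
      obtain v where v: "v \<in> lists ?S" "sum_list v = h" "length v \<le> Suc k"
        using ab'(2,3) unfolding A_def ab'(1) by (rule depth_gens_word_exists)
      have "word_dist integer_group A 0 h \<le> enat (length v)"
        unfolding word_dist_integer_group by (rule INF_lower) (use v in simp)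
      \<comment> \<open>The radius of the ball is the length of \<open>n\<close>; its lower bound
        \<open>Suc k\<close> already places \<open>h\<close> inside.\<close>
      also have "\<dots> \<le> word_dist integer_group A 0 n"
        using v(3) length_n by (meson enat_ord_simps(1) order_trans)
      finally show False using h by (simp add: word_cball_def)
    qed
    then show "enat (Suc k) \<le> enat (length w)" by simp
  qed
  then have "enat k < dead_end_depth integer_group A n"
    by (meson enat_ord_simps(2) lessI less_le_trans)
  moreover have "finite A" by (simp add: A_def depth_gens_def)
  ultimately show ?thesis
    using generating_set_depth_gens[of "2 * n"]
    by (intro exI[of _ A] conjI bexI[of _ n]) (simp_all add: A_def)
qed

end
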